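(* Let $q=1/L$ for an integer $L\ge2$, and fix $0<\varepsilon<1/2$, $1/2<r<1$, and $m\ge1$. Before generating the $p$-values $P_1,\ldots,P_m$, independently declare each coordinate null with probability $\pi_0\in(0,1)$ and alternative with probability $\pi_1=1-\pi_0$. Let $J$ be the resulting label vector. Conditional on $J$, generate the $p$-values from the latent-state model (defined in the context) with those null and alternative coordinates. Write $\mathrm{FDR}_J$ for the FDR of the mirror threshold at level $q$ conditional on the fixed label vector $J$, and let $\mathbb E_J$ denote expectation over the random labels. Put $p_0=1-\varepsilon$, $p_1=\varepsilon$ and, for $h\in\{0,1\}$, $$A_h=\pi_0p_h+\pi_1r,\qquad d_h=\frac{\pi_0p_h}{A_h}.$$ Define $$G_{m,L}(a)=\sum_{\substack{j\ge1\\(L+1)j-1\le m}}\frac{L}{(L+1)j-1}\binom{(L+1)j-1}{j-1}a^{Lj}(1-a)^{j-1},$$ which is the probability that a random walk started at $0$ with independent steps equal to $+1$ with probability $a$ and $-L$ otherwise reaches $L$ within its first $m$ steps. Then $$\mathbb E_J(\mathrm{FDR}_J)=\frac12\sum_{h=0}^1d_h\,G_{m,L}(A_h).$$ Consequently, at least one deterministic null–alternative configuration (label vector) has FDR no smaller than the right-hand side of this identity.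
   Context: Latent-state model: let $H$ be a fair Bernoulli variable. Given $H=h\in\{0,1\}$, the null $p$-values are independent with density $f_h$, where $f_0(u)=2(1-\varepsilon)$ for $0<u<1/2$, $f_0(u)=2\varepsilon$ for $1/2<u<1$, and $f_1(u)=f_0(1-u)$. The alternative $p$-values are independent, independent of $H$ and of the nulls, with density $g_r(u)=2r$ for $0<u<1/2$ and $g_r(u)=2(1-r)$ for $1/2<u<1$. For $p$-values $P_1,\ldots,P_m$ and $0<u\le1/2$, put $R(u)=\#\{i:P_i\le u\}$, $L(u)=\#\{i:P_i\ge1-u\}$ (a counting function, not to be confused with the integer $L$), $\mathcal U=\{\min(P_i,1-P_i):1\le i\le m\}\cap(0,1/2]$. The mirror threshold at level $q$ is $$\widehat u=\max\Big\{u\in\mathcal U:\frac{1+L(u)}{R(u)\vee1}\le q\Big\},$$ with $\widehat u=0$ if the set is empty; the rejection set is $\widehat{\mathcal R}=\{i:P_i\le\widehat u\}$. Here $a\vee b=\max\{a,b\}$. With $\mathcal H_0$ the set of null coordinates, $\mathrm{FDR}=\mathbb E\{|\widehat{\mathcal R}\cap\mathcal H_0|/(|\widehat{\mathcal R}|\vee1)\}$. *)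

theory Defs
  imports "HOL-Probability.Probability"
begin

text \<open>
  A label vector is a function \<open>J :: nat \<Rightarrow> bool\<close> of which only the values on \<open>{1..m}\<close> matter:
  \<open>J i\<close> says that coordinate \<open>i\<close> is null, \<open>\<not> J i\<close> that it is alternative.
\<close>

definition f0_density :: "real \<Rightarrow> real \<Rightarrow> real" where
  "f0_density \<epsilon> u =
     (if 0 < u \<and> u < 1/2 then 2 * (1 - \<epsilon>) else if 1/2 < u \<and> u < 1 then 2 * \<epsilon> else 0)"

text \<open>Used only for \<open>h \<in> {0, 1}\<close>.\<close>

definition null_density :: "real \<Rightarrow> nat \<Rightarrow> real \<Rightarrow> real" where
  "null_density \<epsilon> h u = (if h = 0 then f0_density \<epsilon> u else f0_density \<epsilon> (1 - u))"

definition alt_density :: "real \<Rightarrow> real \<Rightarrow> real" where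
  "alt_density r u =
     (if 0 < u \<and> u < 1/2 then 2 * r else if 1/2 < u \<and> u < 1 then 2 * (1 - r) else 0)"

definition latent_state_pmf :: "nat pmf" where
  "latent_state_pmf = map_pmf of_bool (bernoulli_pmf (1/2))"

definition pvalue_law_given ::
  "real \<Rightarrow> real \<Rightarrow> nat \<Rightarrow> (nat \<Rightarrow> bool) \<Rightarrow> nat \<Rightarrow> (nat \<Rightarrow> real) measure" where
  "pvalue_law_given \<epsilon> r m J h =
     PiM {1..m} (\<lambda>i. density lborel
       (\<lambda>u. ennreal (if J i then null_density \<epsilon> h u else alt_density r u)))"

text \<open>
  The unconditional law of \<open>(P\<^sub>1, \<dots>, P\<^sub>m)\<close> for fixed labels. The nulls share
  one latent state and are therefore only conditionally independent.
\<close>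

definition pvalue_law ::
  "real \<Rightarrow> real \<Rightarrow> nat \<Rightarrow> (nat \<Rightarrow> bool) \<Rightarrow> (nat \<Rightarrow> real) measure" where
  "pvalue_law \<epsilon> r m J = measure_pmf latent_state_pmf \<bind> pvalue_law_given \<epsilon> r m J"

definition R_count :: "nat \<Rightarrow> (nat \<Rightarrow> real) \<Rightarrow> real \<Rightarrow> nat" where
  "R_count m P u = card {i\<in>{1..m}. P i \<le> u}"

definition L_count :: "nat \<Rightarrow> (nat \<Rightarrow> real) \<Rightarrow> real \<Rightarrow> nat" where
  "L_count m P u = card {i\<in>{1..m}. P i \<ge> 1 - u}"

definition mirror_candidates :: "nat \<Rightarrow> (nat \<Rightarrow> real) \<Rightarrow> real set" where
  "mirror_candidates m P = (\<lambda>i. min (P i) (1 - P i)) ` {1..m} \<inter> {0<..1/2}"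

definition mirror_threshold :: "real \<Rightarrow> nat \<Rightarrow> (nat \<Rightarrow> real) \<Rightarrow> real" where
  "mirror_threshold q m P =
     (let S = {u \<in> mirror_candidates m P.
                 (1 + real (L_count m P u)) / real (max (R_count m P u) 1) \<le> q}
      in if S = {} then 0 else Max S)"

definition rejection_set :: "real \<Rightarrow> nat \<Rightarrow> (nat \<Rightarrow> real) \<Rightarrow> nat set" where
  "rejection_set q m P = {i\<in>{1..m}. P i \<le> mirror_threshold q m P}"

definition FDP :: "real \<Rightarrow> nat \<Rightarrow> (nat \<Rightarrow> bool) \<Rightarrow> (nat \<Rightarrow> real) \<Rightarrow> real" where
  "FDP q m J P =
     real (card (rejection_set q m P \<inter> {i\<in>{1..m}. J i})) / real (max (card (rejection_set q m P)) 1)"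

definition FDR :: "real \<Rightarrow> real \<Rightarrow> real \<Rightarrow> nat \<Rightarrow> (nat \<Rightarrow> bool) \<Rightarrow> real" where
  "FDR q \<epsilon> r m J = (\<integral>P. FDP q m J P \<partial>pvalue_law \<epsilon> r m J)"

definition label_pmf :: "nat \<Rightarrow> real \<Rightarrow> (nat \<Rightarrow> bool) pmf" where
  "label_pmf m \<pi>0 = Pi_pmf {1..m} False (\<lambda>_. bernoulli_pmf \<pi>0)"

definition G :: "nat \<Rightarrow> nat \<Rightarrow> real \<Rightarrow> real" where
  "G m L a =
     (\<Sum>j | 1 \<le> j \<and> (L + 1) * j - 1 \<le> m.
        real L / real ((L + 1) * j - 1) * real (((L + 1) * j - 1) choose (j - 1))
          * a ^ (L * j) * (1 - a) ^ (j - 1))"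

definition walk_steps_pmf :: "nat \<Rightarrow> nat \<Rightarrow> real \<Rightarrow> (nat \<Rightarrow> int) pmf" where
  "walk_steps_pmf m L a =
     Pi_pmf {1..m} 0 (\<lambda>_. map_pmf (\<lambda>b. if b then 1 else - int L) (bernoulli_pmf a))"

definition walk_reach_prob :: "nat \<Rightarrow> nat \<Rightarrow> real \<Rightarrow> real" where
  "walk_reach_prob m L a =
     measure_pmf.prob (walk_steps_pmf m L a) {X. \<exists>n\<le>m. (\<Sum>i=1..n. X i) = int L}"

end

theory Submission
  imports Defs
begin

text \<open>
  Given the latent state, every density of the model is constant on either half of \<open>(0, 1)\<close>, so a
  \<open>p\<close>-value is a magnitude \<open>min P (1 - P)\<close>, uniform on \<open>(0, 1/2)\<close>, together with an independent
  sign, and the label affects the sign only. The threshold depends on signs and order of the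
  magnitudes only: if \<open>S\<^sub>k\<close> adds \<open>1\<close> for every small and \<open>-L\<close> for every large \<open>p\<close>-value among the
  \<open>k\<close> smallest magnitudes, the \<open>k\<close>-th magnitude passes the criterion iff \<open>S\<^sub>k \<ge> L\<close>. Hence something
  is rejected iff the walk reaches \<open>L\<close>. With random labels, exchange the order of conditioning and
  draw the sign first (small with probability \<open>A\<^sub>h\<close>) and then the label: rejected coordinates have
  small \<open>p\<close>-values, so each of them is null with conditional probability \<open>d\<^sub>h\<close>, whatever the signs.

  For the hitting probability, \<open>k / (k + (L + 1) d) * binomial (k + (L + 1) d) d\<close> counts the paths
  with \<open>d\<close> downward steps that first reach \<open>k\<close> at their end; both these numbers and the
  probabilities satisfy the recursion given by the first step.
\<close>

section \<open>The hitting-time formula\<close>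

lemma expectation_bind_pmf:
  fixes f :: "'a \<Rightarrow> real"
  assumes "\<And>x. \<bar>f x\<bar> \<le> B"
  shows "measure_pmf.expectation (bind_pmf p k) f =
           measure_pmf.expectation p (\<lambda>x. measure_pmf.expectation (k x) f)"
  unfolding measure_pmf_bind
  by (rule integral_bind[where K = "count_space UNIV" and B' = 1 and B = B])
     (use assms in \<open>auto simp: measure_pmf.finite_measure measure_pmf.emeasure_space_1
        measure_pmf_in_subprob_space\<close>)

lemma prob_bind_pmf:
  "measure_pmf.prob (bind_pmf p k) S = measure_pmf.expectation p (\<lambda>x. measure_pmf.prob (k x) S)"
  using expectation_bind_pmf[of "indicator S" 1 p k] by simp

definition walk_step :: "nat \<Rightarrow> real \<Rightarrow> int pmf" where
  "walk_step L a = map_pmf (\<lambda>b. if b then 1 else - int L) (bernoulli_pmf a)"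

definition walk_hits :: "nat \<Rightarrow> nat \<Rightarrow> nat \<Rightarrow> (nat \<Rightarrow> int) set" where
  "walk_hits l M k = {X. \<exists>n\<in>{l..M}. (\<Sum>i=l..<n. X i) = int k}"

definition hit_prob :: "nat \<Rightarrow> real \<Rightarrow> nat \<Rightarrow> nat \<Rightarrow> nat \<Rightarrow> real" where
  "hit_prob L a l M k = measure_pmf.prob (Pi_pmf {l..<M} 0 (\<lambda>_. walk_step L a)) (walk_hits l M k)"

lemma hit_prob_0: "l \<le> M \<Longrightarrow> hit_prob L a l M 0 = 1"
proof -
  assume "l \<le> M"
  then have "walk_hits l M 0 = UNIV" by (force simp: walk_hits_def)
  then show ?thesis by (simp add: hit_prob_def)
qed

lemma hit_prob_self: "k > 0 \<Longrightarrow> hit_prob L a M M k = 0"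
  by (simp add: hit_prob_def walk_hits_def)

lemma walk_hits_update:
  assumes "l < M" "k > 0"
  shows "X(l := x) \<in> walk_hits l M k \<longleftrightarrow> (\<exists>n\<in>{Suc l..M}. x + (\<Sum>i=Suc l..<n. X i) = int k)"
proof -
  have "(\<Sum>i=l..<n. (X(l := x)) i) = x + (\<Sum>i=Suc l..<n. X i)" if "n \<ge> Suc l" for n
  proof -
    have "(\<Sum>i=l..<n. (X(l := x)) i) = x + (\<Sum>i=Suc l..<n. (X(l := x)) i)"
      using that by (subst sum.atLeast_Suc_lessThan) auto
    also have "(\<Sum>i=Suc l..<n. (X(l := x)) i) = (\<Sum>i=Suc l..<n. X i)"
      by (intro sum.cong) auto
    finally show ?thesis .
  qed
  moreover have "{l..M} = insert l {Suc l..M}"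
    using assms by auto
  ultimately show ?thesis
    using assms by (auto simp: walk_hits_def)
qed

lemma hit_prob_Suc:
  assumes "a \<in> {0..1}" "l < M"
  shows "hit_prob L a l M (Suc k) =
           a * hit_prob L a (Suc l) M k + (1 - a) * hit_prob L a (Suc l) M (Suc k + L)"
proof -
  let ?Q = "Pi_pmf {Suc l..<M} 0 (\<lambda>_. walk_step L a)"
  let ?g = "\<lambda>b. if b then 1 else - int L"
  have "{l..<M} = insert l {Suc l..<M}"
    using assms by auto
  then have "Pi_pmf {l..<M} 0 (\<lambda>_. walk_step L a) =
      bernoulli_pmf a \<bind> (\<lambda>b. map_pmf (\<lambda>X. X(l := ?g b)) ?Q)"
    by (simp add: Pi_pmf_insert' walk_step_def map_pmf_def bind_assoc_pmf bind_return_pmf)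
  then have "hit_prob L a l M (Suc k) =
     measure_pmf.expectation (bernoulli_pmf a)
       (\<lambda>b. measure_pmf.prob ?Q {X. X(l := ?g b) \<in> walk_hits l M (Suc k)})"
    by (simp add: hit_prob_def prob_bind_pmf vimage_def del: integral_bernoulli_pmf)
  moreover have "{X. X(l := ?g True) \<in> walk_hits l M (Suc k)} = walk_hits (Suc l) M k"
    using assms by (auto simp: walk_hits_update) (auto simp: walk_hits_def)
  moreover have "{X. X(l := ?g False) \<in> walk_hits l M (Suc k)} = walk_hits (Suc l) M (Suc k + L)"
    using assms by (auto simp: walk_hits_update) (force simp: walk_hits_def)+
  ultimately show ?thesis
    using assms by (simp add: hit_prob_def algebra_simps)
qed

definition hit_coeff :: "nat \<Rightarrow> nat \<Rightarrow> nat \<Rightarrow> real" where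
  "hit_coeff L k d =
     (if d = 0 then 1
      else real k / real (k + (L + 1) * d) * real ((k + (L + 1) * d) choose d))"

lemma hit_coeff_Suc:
  "hit_coeff L (Suc k) (Suc d) = hit_coeff L k (Suc d) + hit_coeff L (Suc k + L) d"
proof -
  define N where "N = k + (L + 1) * Suc d"
  have N: "Suc k + (L + 1) * Suc d = Suc N" "Suc k + L + (L + 1) * d = N" "N > 0" "d < N"
    by (simp_all add: N_def)
  have 1: "real (Suc N choose Suc d) = real (Suc N) / real (Suc d) * real (N choose d)"
    using Suc_times_binomial[of d N] by (simp add: field_simps flip: of_nat_mult)
  have "Suc d * (N choose Suc d) = (N - d) * (N choose d)"
    using binomial_absorb_comp[of N d] binomial_absorption[of d N] by simp
  then have "real (Suc d) * real (N choose Suc d) = real (N - d) * real (N choose d)"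
    by (metis of_nat_mult)
  then have 2: "real (N choose Suc d) = (real N - real d) / real (Suc d) * real (N choose d)"
    using N(4) by (simp add: field_simps)
  have 3: "hit_coeff L (Suc k + L) d = real (Suc k + L) / real N * real (N choose d)"
    unfolding hit_coeff_def N(2) using N by (cases "d = 0") auto
  have "real k * (real N - real d) + real (Suc k + L) * real (Suc d) = real (Suc k) * real N"
    by (simp add: N_def algebra_simps)
  then have "real k * (real N - real d) / real (Suc d) + real (Suc k + L) =
      real (Suc k) * real N / real (Suc d)"
    by (subst divide_add_eq_iff) (simp, simp only:)
  then have "real (Suc k) / real (Suc d) =
      (real k * (real N - real d) / real (Suc d) + real (Suc k + L)) / real N"
    using N(3) by simp
  then have "real (Suc k) / real (Suc d) * real (N choose d) =
      (real k * (real N - real d) / real (Suc d) + real (Suc k + L)) / real N * real (N choose d)"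
    by simp
  moreover have "hit_coeff L (Suc k) (Suc d) = real (Suc k) / real (Suc d) * real (N choose d)"
    unfolding hit_coeff_def N(1) 1 by simp
  moreover have "hit_coeff L k (Suc d) =
      real k * (real N - real d) / real (Suc d) / real N * real (N choose d)"
    unfolding hit_coeff_def N_def[symmetric] 2 by (simp add: mult_ac)
  ultimately show ?thesis
    unfolding 3 by (simp add: add_divide_distrib ring_distribs)
qed

definition hit_term :: "nat \<Rightarrow> real \<Rightarrow> nat \<Rightarrow> nat \<Rightarrow> nat \<Rightarrow> real" where
  "hit_term L a n k d =
     (if k + (L + 1) * d \<le> n then hit_coeff L k d * a ^ (k + L * d) * (1 - a) ^ d else 0)"

lemma hit_term_Suc_0: "hit_term L a (Suc n) (Suc k) 0 = a * hit_term L a n k 0"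
  by (simp add: hit_term_def hit_coeff_def)

lemma hit_term_Suc_Suc:
  "hit_term L a (Suc n) (Suc k) (Suc d) =
     a * hit_term L a n k (Suc d) + (1 - a) * hit_term L a n (Suc k + L) d"
  by (simp add: hit_term_def hit_coeff_Suc algebra_simps power_add)

lemma sum_hit_term_Suc:
  "(\<Sum>d\<le>Suc n. hit_term L a (Suc n) (Suc k) d) =
     a * (\<Sum>d\<le>n. hit_term L a n k d) + (1 - a) * (\<Sum>d\<le>n. hit_term L a n (Suc k + L) d)"
proof -
  have "(\<Sum>d\<le>Suc n. hit_term L a (Suc n) (Suc k) d) =
      a * (\<Sum>d\<le>Suc n. hit_term L a n k d) + (1 - a) * (\<Sum>d\<le>n. hit_term L a n (Suc k + L) d)"
    unfolding sum.atMost_Suc_shift hit_term_Suc_0 hit_term_Suc_Suc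
    by (simp add: sum.distrib sum_distrib_left distrib_left)
  moreover have "hit_term L a n k (Suc n) = 0"
    by (simp add: hit_term_def)
  ultimately show ?thesis by simp
qed

lemma hit_prob_eq_sum:
  assumes "a \<in> {0..1}"
  shows "hit_prob L a l (l + n) k = (\<Sum>d\<le>n. hit_term L a n k d)"
proof (induction n arbitrary: l k)
  case 0
  show ?case
    by (cases k) (simp_all add: hit_prob_0 hit_prob_self hit_term_def hit_coeff_def)
next
  case (Suc n)
  show ?case
  proof (cases k)
    case 0
    have "(\<Sum>d\<le>Suc n. hit_term L a (Suc n) 0 d) = 1"
      unfolding sum.atMost_Suc_shift by (auto simp: hit_term_def hit_coeff_def intro!: sum.neutral)
    with 0 show ?thesis by (simp add: hit_prob_0)
  next
    case (Suc k')
    then show ?thesis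
      using hit_prob_Suc[OF assms, of l "l + Suc n" L k'] Suc.IH[of "Suc l"]
      by (simp add: sum_hit_term_Suc del: sum.atMost_Suc)
  qed
qed

lemma walk_reach_prob_eq_hit_prob: "walk_reach_prob m L a = hit_prob L a 1 (1 + m) L"
proof -
  have "(\<exists>n\<le>m. (\<Sum>i=1..n. X i) = int L) \<longleftrightarrow> (\<exists>n\<in>{1..1 + m}. (\<Sum>i=1..<n. X i) = int L)"
    for X :: "nat \<Rightarrow> int"
  proof
    assume "\<exists>n\<le>m. (\<Sum>i=1..n. X i) = int L"
    then obtain n where "n \<le> m" "(\<Sum>i=1..n. X i) = int L" by auto
    then show "\<exists>n\<in>{1..1 + m}. (\<Sum>i=1..<n. X i) = int L"
      by (intro bexI[of _ "Suc n"]) (auto simp: atLeastLessThanSuc_atLeastAtMost)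
  next
    assume "\<exists>n\<in>{1..1 + m}. (\<Sum>i=1..<n. X i) = int L"
    then obtain n where "n \<in> {1..1 + m}" "(\<Sum>i=1..<n. X i) = int L" by auto
    then show "\<exists>n\<le>m. (\<Sum>i=1..n. X i) = int L"
      by (intro exI[of _ "n - 1"]) (cases n; auto simp: atLeastLessThanSuc_atLeastAtMost)
  qed
  moreover have "{1..<1 + m} = {1..m}" by auto
  ultimately show ?thesis
    by (simp add: walk_reach_prob_def hit_prob_def walk_steps_pmf_def walk_hits_def walk_step_def)
qed

lemma G_eq_walk_reach_prob:
  assumes "L \<ge> 2" "a \<in> {0..1}"
  shows "G m L a = walk_reach_prob m L a"
proof -
  have "G m L a = (\<Sum>d | L + (L + 1) * d \<le> m. hit_term L a m L d)"
    unfolding G_def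
  proof (intro sum.reindex_bij_witness[of _ Suc "\<lambda>j. j - 1"], goal_cases)
    case (5 j)
    then obtain d where "j = Suc d" by (cases j) auto
    with 5 assms(1) show ?case
      by (auto simp: hit_term_def hit_coeff_def algebra_simps power_add)
  qed (auto simp: algebra_simps Suc_diff_le)
  also have "\<dots> = (\<Sum>d\<le>m. hit_term L a m L d)"
    by (intro sum.mono_neutral_left) (auto simp: hit_term_def)
  finally show ?thesis
    using assms(2) by (simp add: walk_reach_prob_eq_hit_prob hit_prob_eq_sum del: One_nat_def)
qed

section \<open>Mirrored uniform magnitudes\<close>

definition half_uniform :: "real measure" where
  "half_uniform = uniform_measure lborel {0<..<1/2}"

definition signed_pvalue :: "bool \<Rightarrow> real \<Rightarrow> real" where
  "signed_pvalue b u = (if b then u else 1 - u)"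

definition signed_pvalues :: "nat set \<Rightarrow> (nat \<Rightarrow> bool) \<Rightarrow> (nat \<Rightarrow> real) \<Rightarrow> nat \<Rightarrow> real" where
  "signed_pvalues I s U = (\<lambda>i\<in>I. signed_pvalue (s i) (U i))"

lemma prob_space_half_uniform: "prob_space half_uniform"
  unfolding half_uniform_def by (intro prob_space_uniform_measure) auto

lemma sets_half_uniform [simp, measurable_cong]: "sets half_uniform = sets borel"
  by (simp add: half_uniform_def)

lemma space_half_uniform [simp]: "space half_uniform = UNIV"
  by (simp add: half_uniform_def)

lemma measurable_signed_pvalue [measurable]: "signed_pvalue b \<in> borel_measurable borel"
  unfolding signed_pvalue_def by measurable

lemma measurable_signed_pvalues [measurable]:
  "signed_pvalues I s \<in> measurable (PiM I (\<lambda>_. half_uniform)) (PiM I (\<lambda>_. borel))"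
  unfolding signed_pvalues_def by measurable

lemma emeasure_half_uniform:
  assumes "A \<in> sets borel"
  shows "emeasure half_uniform A = 2 * emeasure lborel ({0<..<1/2} \<inter> A)"
proof -
  have "inverse (ennreal (1 / 2)) = 2"
    by (subst inverse_ennreal) auto
  then show ?thesis
    using assms by (simp add: half_uniform_def divide_ennreal_def mult.commute)
qed

lemma emeasure_lborel_reflect:
  assumes [measurable]: "A \<in> sets borel"
  shows "emeasure lborel ((\<lambda>u. 1 - u) -` A) = emeasure lborel (A :: real set)"
proof -
  have "emeasure lborel A = (\<integral>\<^sup>+x. indicator A x \<partial>lborel)"
    by simp
  also have "\<dots> = (\<integral>\<^sup>+x. indicator A (1 + - 1 * x) \<partial>lborel)"
    by (subst nn_integral_real_affine[where c = "-1" and t = 1]) simp_all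
  also have "\<dots> = (\<integral>\<^sup>+x. indicator ((\<lambda>u. 1 - u) -` A) x \<partial>lborel)"
    by (intro nn_integral_cong) (auto simp: indicator_def)
  also have "\<dots> = emeasure lborel ((\<lambda>u. 1 - u) -` A)"
    by (intro nn_integral_indicator) (simp add: measurable_sets_borel[OF _ assms])
  finally show ?thesis by simp
qed

lemma emeasure_f0_density:
  assumes c: "c \<in> {0..1}" and [measurable]: "A \<in> sets borel"
  shows "emeasure (density lborel (\<lambda>u. ennreal (f0_density (1 - c) u))) A =
    (\<integral>\<^sup>+b. emeasure half_uniform (signed_pvalue b -` A) \<partial>bernoulli_pmf c)"
proof -
  have "emeasure (density lborel (\<lambda>u. ennreal (f0_density (1 - c) u))) A =
      (\<integral>\<^sup>+u. ennreal (f0_density (1 - c) u) * indicator A u \<partial>lborel)"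
    by (intro emeasure_density) (auto simp: f0_density_def)
  also have "\<dots> = (\<integral>\<^sup>+u. ennreal (2 * c) * indicator ({0<..<1/2} \<inter> A) u +
                        ennreal (2 * (1 - c)) * indicator ({1/2<..<1} \<inter> A) u \<partial>lborel)"
    using c by (intro nn_integral_cong) (auto simp: f0_density_def indicator_def)
  also have "\<dots> = ennreal (2 * c) * emeasure lborel ({0<..<1/2} \<inter> A) +
                  ennreal (2 * (1 - c)) * emeasure lborel ({1/2<..<1} \<inter> A)"
    by (subst nn_integral_add) (auto simp: nn_integral_cmult_indicator)
  also have "emeasure lborel ({1/2<..<1} \<inter> A) =
      emeasure lborel ((\<lambda>u. 1 - u) -` ({1/2<..<1} \<inter> A))"
    by (subst emeasure_lborel_reflect) auto
  also have "(\<lambda>u. 1 - u) -` ({1/2<..<1} \<inter> A) = {0<..<1/2} \<inter> signed_pvalue False -` A"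
    by (auto simp: signed_pvalue_def)
  also have "{0<..<1/2} \<inter> A = {0<..<1/2} \<inter> signed_pvalue True -` A"
    by (auto simp: signed_pvalue_def)
  also have "ennreal (2 * c) * emeasure lborel ({0<..<1/2} \<inter> signed_pvalue True -` A) +
        ennreal (2 * (1 - c)) * emeasure lborel ({0<..<1/2} \<inter> signed_pvalue False -` A) =
      emeasure half_uniform (signed_pvalue True -` A) * ennreal c +
        emeasure half_uniform (signed_pvalue False -` A) * ennreal (1 - c)"
    using c ennreal_mult'[of 2 c] ennreal_mult'[of 2 "1 - c"]
    by (simp add: emeasure_half_uniform measurable_sets_borel[OF measurable_signed_pvalue] mult_ac
        del: ennreal_mult')
  finally show ?thesis
    using c by (simp add: ennreal_minus)
qed

lemma prob_space_f0_density:
  assumes "c \<in> {0..1}"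
  shows "prob_space (density lborel (\<lambda>u. ennreal (f0_density (1 - c) u)))"
proof
  interpret prob_space half_uniform by (rule prob_space_half_uniform)
  show "emeasure (density lborel (\<lambda>u. ennreal (f0_density (1 - c) u)))
      (space (density lborel (\<lambda>u. ennreal (f0_density (1 - c) u)))) = 1"
    using emeasure_f0_density[OF assms, of UNIV] emeasure_space_1 assms
    by (simp flip: ennreal_plus)
qed

lemma PiM_f0_density_eq_bind:
  assumes I: "finite I" and c: "\<And>i. c i \<in> {0..1}"
  shows "PiM I (\<lambda>i. density lborel (\<lambda>u. ennreal (f0_density (1 - c i) u))) =
    measure_pmf (Pi_pmf I False (\<lambda>i. bernoulli_pmf (c i))) \<bind>
      (\<lambda>s. distr (PiM I (\<lambda>_. half_uniform)) (PiM I (\<lambda>_. borel)) (signed_pvalues I s))"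
    (is "PiM I ?M = measure_pmf ?S \<bind> ?K")
proof -
  interpret U: product_prob_space "\<lambda>_. half_uniform" I
    by (intro product_prob_spaceI prob_space_half_uniform)
  interpret product_prob_space ?M I
    by (intro product_prob_spaceI prob_space_f0_density c)
  have K: "?K \<in> measurable (measure_pmf ?S) (subprob_algebra (PiM I (\<lambda>_. borel)))"
    by (auto simp: space_subprob_algebra intro!: prob_space_imp_subprob_space U.prob_space_distr)
  have sets: "sets (PiM I ?M) = sets (PiM I (\<lambda>_. borel))"
    by (intro sets_PiM_cong) auto
  have "measure_pmf ?S \<bind> ?K = PiM I ?M"
  proof (rule PiM_eqI)
    show "sets (measure_pmf ?S \<bind> ?K) = sets (PiM I ?M)"
      unfolding sets by (rule sets_bind) auto
  next
    fix A assume "\<And>i. i \<in> I \<Longrightarrow> A i \<in> sets (?M i)"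
    then have A: "A i \<in> sets borel" if "i \<in> I" for i
      using that by simp
    have "emeasure (?K s) (Pi\<^sub>E I A) = (\<Prod>i\<in>I. emeasure half_uniform (signed_pvalue (s i) -` A i))" for s
    proof -
      have "signed_pvalues I s -` Pi\<^sub>E I A \<inter> space (PiM I (\<lambda>_. half_uniform)) =
          Pi\<^sub>E I (\<lambda>i. signed_pvalue (s i) -` A i)"
        by (auto simp: signed_pvalues_def space_PiM PiE_iff)
      moreover have "Pi\<^sub>E I A \<in> sets (PiM I (\<lambda>_. borel))"
        using I A by (intro sets_PiM_I_finite) auto
      ultimately show ?thesis
        using I A measurable_sets_borel[OF measurable_signed_pvalue]
        by (simp add: emeasure_distr U.emeasure_PiM)
    qed
    then have "emeasure (measure_pmf ?S \<bind> ?K) (Pi\<^sub>E I A) =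
        (\<integral>\<^sup>+s. (\<Prod>i\<in>I. emeasure half_uniform (signed_pvalue (s i) -` A i)) \<partial>?S)"
      using I A by (subst emeasure_bind[OF _ K]) (auto intro!: sets_PiM_I_finite)
    also have "\<dots> = (\<Prod>i\<in>I. \<integral>\<^sup>+b. emeasure half_uniform (signed_pvalue b -` A i) \<partial>bernoulli_pmf (c i))"
      by (rule nn_integral_prod_Pi_pmf) fact
    also have "\<dots> = (\<Prod>i\<in>I. emeasure (?M i) (A i))"
      using A c by (intro prod.cong refl emeasure_f0_density[symmetric]) auto
    finally show "emeasure (measure_pmf ?S \<bind> ?K) (Pi\<^sub>E I A) = (\<Prod>i\<in>I. emeasure (?M i) (A i))" .
  qed (use I in auto)
  then show ?thesis ..
qed

lemma integral_PiM_f0_density: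
  fixes F :: "(nat \<Rightarrow> real) \<Rightarrow> real"
  assumes I: "finite I" and c: "\<And>i. c i \<in> {0..1}"
    and F [measurable]: "F \<in> borel_measurable (PiM I (\<lambda>_. borel))"
    and bounded: "\<And>P. \<bar>F P\<bar> \<le> B"
  shows "(\<integral>P. F P \<partial>PiM I (\<lambda>i. density lborel (\<lambda>u. ennreal (f0_density (1 - c i) u)))) =
    measure_pmf.expectation (Pi_pmf I False (\<lambda>i. bernoulli_pmf (c i)))
      (\<lambda>s. \<integral>U. F (signed_pvalues I s U) \<partial>PiM I (\<lambda>_. half_uniform))"
proof -
  interpret U: product_prob_space "\<lambda>_. half_uniform" I
    by (intro product_prob_spaceI prob_space_half_uniform)
  show ?thesis
    unfolding PiM_f0_density_eq_bind[OF I c]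
    by (subst integral_bind[where K = "PiM I (\<lambda>_. borel)" and B = B and B' = 1])
       (auto simp: space_subprob_algebra integral_distr measure_pmf.finite_measure
         measure_pmf.emeasure_space_1 bounded emeasure_distr U.emeasure_space_1
         intro!: prob_space_imp_subprob_space U.prob_space_distr AE_I2 U.emeasure_le_1)
qed

lemma AE_half_uniform_inj:
  assumes I: "finite I"
  shows "AE U in PiM I (\<lambda>_. half_uniform). inj_on U I \<and> (\<forall>i\<in>I. U i \<in> {0<..<1/2})"
proof -
  interpret U: product_prob_space "\<lambda>_. half_uniform" I
    by (intro product_prob_spaceI prob_space_half_uniform)
  have "AE U in PiM I (\<lambda>_. half_uniform). U i \<noteq> U j" if "i \<in> I" "j \<in> I" "i \<noteq> j" for i j
  proof -
    define I' where "I' = I - {i}"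
    have I': "I = insert i I'" "finite I'" "i \<notin> I'" "j \<in> I'"
      using that I by (auto simp: I'_def)
    have [measurable]: "(\<lambda>U. U i) \<in> borel_measurable (PiM I (\<lambda>_. half_uniform))"
      "(\<lambda>U. U j) \<in> borel_measurable (PiM I (\<lambda>_. half_uniform))"
      using that by (auto intro: measurable_component_singleton[of _ I "\<lambda>_. half_uniform", simplified])
    define N where "N = {U \<in> space (PiM I (\<lambda>_. half_uniform)). U i = U j}"
    have N: "N \<in> sets (PiM I (\<lambda>_. half_uniform))"
      unfolding N_def by measurable
    have "emeasure (PiM I (\<lambda>_. half_uniform)) N =
        (\<integral>\<^sup>+U. indicator N U \<partial>PiM I (\<lambda>_. half_uniform))"
      using N by simp
    also have "\<dots> = (\<integral>\<^sup>+V. \<integral>\<^sup>+u. indicator N (V(i := u)) \<partial>half_uniform \<partial>PiM I' (\<lambda>_. half_uniform))"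
      using I' N by (subst I'(1), subst U.product_nn_integral_insert) (auto simp: I'(1))
    also have "\<dots> \<le> (\<integral>\<^sup>+V. \<integral>\<^sup>+u. indicator {V j} u \<partial>half_uniform \<partial>PiM I' (\<lambda>_. half_uniform))"
      using that by (intro nn_integral_mono) (auto simp: indicator_def N_def)
    also have "\<dots> = 0"
      by (simp add: emeasure_half_uniform emeasure_lborel_countable)
    finally show ?thesis
      using N by (intro AE_I[where N = N]) (auto simp: N_def)
  qed
  moreover have "AE U in PiM I (\<lambda>_. half_uniform). U i \<in> {0<..<1/2}" if "i \<in> I" for i
  proof (rule AE_PiM_component[OF prob_space_half_uniform that])
    show "AE u in half_uniform. u \<in> {0<..<1/2}"
      unfolding half_uniform_def by (rule AE_uniform_measureI) auto
  qed
  ultimately have "AE U in PiM I (\<lambda>_. half_uniform). \<forall>i\<in>I. U i \<in> {0<..<1/2} \<and> (\<forall>j\<in>I. i \<noteq> j \<longrightarrow> U i \<noteq> U j)"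
    using I by (auto intro!: AE_finite_allI)
  then show ?thesis
    by eventually_elim (auto simp: inj_on_def)
qed

section \<open>The mirror threshold as a random walk\<close>

declare One_nat_def [simp del]

lemma of_nat_card_filter:
  "finite A \<Longrightarrow> real (card {i\<in>A. Q i}) = (\<Sum>i\<in>A. if Q i then 1 else 0)"
  by (simp add: sum.If_cases Int_def)

lemma borel_measurable_card_filter:
  assumes "finite A" and Q: "\<And>i. i \<in> A \<Longrightarrow> Measurable.pred M (Q i)"
  shows "(\<lambda>x. real (card {i\<in>A. Q i x})) \<in> borel_measurable M"
  unfolding of_nat_card_filter[OF assms(1)]
proof (rule borel_measurable_sum)
  fix i assume "i \<in> A"
  note [measurable] = Q[OF this]
  show "(\<lambda>x. if Q i x then 1 else 0 :: real) \<in> borel_measurable M"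
    by measurable
qed

lemma borel_measurable_pred_le:
  fixes f g :: "'a \<Rightarrow> real"
  assumes [measurable]: "f \<in> borel_measurable M" "g \<in> borel_measurable M"
  shows "Measurable.pred M (\<lambda>x. f x \<le> g x)"
  by measurable

lemma mem_rejection_set_iff:
  "i \<in> rejection_set q m P \<longleftrightarrow> i \<in> {1..m} \<and>
    (let u = \<lambda>k. min (P k) (1 - P k);
         C = \<lambda>k. 0 < u k \<and> u k \<le> 1/2 \<and>
               (1 + real (L_count m P (u k))) / real (max (R_count m P (u k)) 1) \<le> q
     in (\<exists>k\<in>{1..m}. C k \<and> P i \<le> u k) \<or> ((\<forall>k\<in>{1..m}. \<not> C k) \<and> P i \<le> 0))"
proof -
  define u where "u k = min (P k) (1 - P k)" for k
  define C where "C k \<longleftrightarrow> 0 < u k \<and> u k \<le> 1/2 \<and>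
    (1 + real (L_count m P (u k))) / real (max (R_count m P (u k)) 1) \<le> q" for k
  define S where "S = {v \<in> mirror_candidates m P.
    (1 + real (L_count m P v)) / real (max (R_count m P v) 1) \<le> q}"
  have S: "S = u ` {k\<in>{1..m}. C k}"
    by (auto simp: S_def mirror_candidates_def C_def u_def)
  then have "finite S" by simp
  have "P i \<le> mirror_threshold q m P \<longleftrightarrow>
      (\<exists>k\<in>{1..m}. C k \<and> P i \<le> u k) \<or> ((\<forall>k\<in>{1..m}. \<not> C k) \<and> P i \<le> 0)"
  proof (cases "S = {}")
    case True
    moreover from True have "\<forall>k\<in>{1..m}. \<not> C k" using S by auto
    ultimately show ?thesis
      unfolding mirror_threshold_def S_def[symmetric] by auto
  next
    case False
    then have "P i \<le> mirror_threshold q m P \<longleftrightarrow> (\<exists>v\<in>S. P i \<le> v)"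
      using \<open>finite S\<close> unfolding mirror_threshold_def S_def[symmetric] by (simp add: Max_ge_iff)
    then show ?thesis using False S by auto
  qed
  then show ?thesis
    by (simp only: rejection_set_def mem_Collect_eq C_def u_def Let_def)
qed

lemma measurable_FDP [measurable]:
  "FDP q m J \<in> borel_measurable (PiM {1..m} (\<lambda>_. borel))"
proof -
  let ?M = "PiM {1..m} (\<lambda>_. borel) :: (nat \<Rightarrow> real) measure"
  have component: "(\<lambda>P. P k) \<in> borel_measurable ?M" if "k \<in> {1..m}" for k
    using that by measurable
  define v where "v k P = min (P k) (1 - P k)" for k and P :: "nat \<Rightarrow> real"
  have v: "v k \<in> borel_measurable ?M" if "k \<in> {1..m}" for k
    unfolding v_def using component[OF that] by simp
  have R: "(\<lambda>P. real (R_count m P (v k P))) \<in> borel_measurable ?M" if "k \<in> {1..m}" for k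
    unfolding R_count_def using that
    by (intro borel_measurable_card_filter borel_measurable_pred_le component v) auto
  have L: "(\<lambda>P. real (L_count m P (v k P))) \<in> borel_measurable ?M" if "k \<in> {1..m}" for k
    unfolding L_count_def using that
    by (intro borel_measurable_card_filter borel_measurable_pred_le borel_measurable_diff
        borel_measurable_const component v) auto
  define C where "C k P \<longleftrightarrow> 0 < v k P \<and> v k P \<le> 1/2 \<and>
    (1 + real (L_count m P (v k P))) / real (max (R_count m P (v k P)) 1) \<le> q" for k P
  have C: "Measurable.pred ?M (C k)" if "k \<in> {1..m}" for k
  proof -
    note [measurable] = v[OF that] R[OF that] L[OF that]
    show ?thesis unfolding C_def of_nat_max by measurable
  qed
  have rej: "Measurable.pred ?M (\<lambda>P. i \<in> rejection_set q m P)" if i: "i \<in> {1..m}" for i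
  proof -
    have "i \<in> rejection_set q m P \<longleftrightarrow>
        (\<exists>k\<in>{1..m}. C k P \<and> P i \<le> v k P) \<or> ((\<forall>k\<in>{1..m}. \<not> C k P) \<and> P i \<le> 0)" for P
      using i unfolding mem_rejection_set_iff Let_def C_def v_def by blast
    moreover have "Measurable.pred ?M (\<lambda>P.
        (\<exists>k\<in>{1..m}. C k P \<and> P i \<le> v k P) \<or> ((\<forall>k\<in>{1..m}. \<not> C k P) \<and> P i \<le> 0))"
      by (intro pred_intros_logic pred_intros_finite finite_atLeastAtMost
          borel_measurable_pred_le borel_measurable_const C v component i)
    ultimately show ?thesis by presburger
  qed
  have "rejection_set q m P \<inter> {i\<in>{1..m}. J i} = {i\<in>{1..m}. i \<in> rejection_set q m P \<and> J i}"
    and "rejection_set q m P = {i\<in>{1..m}. i \<in> rejection_set q m P}" for P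
    by (auto simp: rejection_set_def)
  then have "FDP q m J = (\<lambda>P.
      real (card {i\<in>{1..m}. i \<in> rejection_set q m P \<and> J i}) /
      max (real (card {i\<in>{1..m}. i \<in> rejection_set q m P})) 1)"
    by (simp add: FDP_def[abs_def] of_nat_max)
  then show ?thesis
    by (simp only:) (intro borel_measurable_divide borel_measurable_max borel_measurable_const
        borel_measurable_card_filter pred_intros_logic finite_atLeastAtMost rej; simp)
qed

lemma finite_rejection_set [simp]: "finite (rejection_set q m P)"
  by (simp add: rejection_set_def)

lemma abs_FDP_le_1: "\<bar>FDP q m J P\<bar> \<le> 1"
proof -
  have "card (rejection_set q m P \<inter> {i\<in>{1..m}. J i}) \<le> card (rejection_set q m P)"
    by (intro card_mono) auto
  then show ?thesis
    by (simp add: FDP_def divide_le_eq max.coboundedI1)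
qed

lemma ex_sorting_permutation:
  fixes U :: "nat \<Rightarrow> 'a::linorder"
  assumes "inj_on U {1..m}"
  obtains \<sigma> where "bij_betw \<sigma> {1..m} {1..m}" "\<And>i. i \<notin> {1..m} \<Longrightarrow> \<sigma> i \<notin> {1..m}"
    "\<And>i j. i \<in> {1..m} \<Longrightarrow> j \<in> {1..m} \<Longrightarrow> U (\<sigma> i) \<le> U (\<sigma> j) \<longleftrightarrow> i \<le> j"
proof -
  define xs where "xs = sorted_list_of_set (U ` {1..m})"
  have len: "length xs = m"
    using assms by (simp add: xs_def card_image)
  have sorted: "sorted_wrt (<) xs" and set: "set xs = U ` {1..m}"
    by (simp_all add: xs_def)
  then have mono: "xs ! i \<le> xs ! j \<longleftrightarrow> i \<le> j" if "i < m" "j < m" for i j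
    using sorted_wrt_nth_less[OF sorted, of i j] sorted_wrt_nth_less[OF sorted, of j i] that len
    by (cases i j rule: linorder_cases) auto
  have bij_U: "bij_betw U {1..m} (set xs)"
    using assms by (simp add: bij_betw_def set)
  define \<tau> where "\<tau> i = the_inv_into {1..m} U (xs ! (i - 1))" for i
  have "bij_betw (\<lambda>i::nat. i - 1) {1..m} {..<m}"
    by (rule bij_betw_byWitness[where f' = Suc]) auto
  moreover have "bij_betw ((!) xs) {..<m} (set xs)"
    using sorted len by (intro bij_betw_nth) (auto simp: strict_sorted_iff)
  ultimately have "bij_betw (the_inv_into {1..m} U \<circ> ((!) xs \<circ> (\<lambda>i. i - 1))) {1..m} {1..m}"
    using bij_betw_the_inv_into[OF bij_U] by (intro bij_betw_trans)
  then have bij: "bij_betw \<tau> {1..m} {1..m}"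
    by (simp add: \<tau>_def comp_def cong: bij_betw_cong)
  have U: "U (\<tau> i) = xs ! (i - 1)" if "i \<in> {1..m}" for i
    unfolding \<tau>_def using that len set
    by (intro f_the_inv_into_f_bij_betw[OF bij_U]) (metis Suc_pred' atLeastAtMost_iff less_eq_Suc_le nth_mem One_nat_def)
  show ?thesis
  proof (rule that[of "\<lambda>i. if i \<in> {1..m} then \<tau> i else i"])
    show "bij_betw (\<lambda>i. if i \<in> {1..m} then \<tau> i else i) {1..m} {1..m}"
      by (rule iffD2[OF bij_betw_cong bij]) auto
  next
    fix i j assume "i \<in> {1..m}" "j \<in> {1..m}"
    moreover from this have "i - 1 < m" "j - 1 < m" "i - 1 \<le> j - 1 \<longleftrightarrow> i \<le> j"
      by auto
    ultimately show "U (if i \<in> {1..m} then \<tau> i else i) \<le> U (if j \<in> {1..m} then \<tau> j else j) \<longleftrightarrow> i \<le> j"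
      using mono[of "i - 1" "j - 1"] U by auto
  qed auto
qed

locale sorted_magnitudes =
  fixes m L :: nat and U :: "nat \<Rightarrow> real" and \<sigma> :: "nat \<Rightarrow> nat"
  assumes L: "L \<ge> 2"
    and U: "\<And>i. i \<in> {1..m} \<Longrightarrow> U i \<in> {0<..<1/2}"
    and bij: "bij_betw \<sigma> {1..m} {1..m}"
    and sorted: "\<And>i j. i \<in> {1..m} \<Longrightarrow> j \<in> {1..m} \<Longrightarrow> U (\<sigma> i) \<le> U (\<sigma> j) \<longleftrightarrow> i \<le> j"
begin

definition walk :: "(nat \<Rightarrow> bool) \<Rightarrow> nat \<Rightarrow> int" where
  "walk s n = (\<Sum>j=1..n. if s (\<sigma> j) then 1 else - int L)"

abbreviation pvalues :: "(nat \<Rightarrow> bool) \<Rightarrow> nat \<Rightarrow> real" where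
  "pvalues s \<equiv> signed_pvalues {1..m} s U"

lemma \<sigma>_in: "k \<in> {1..m} \<Longrightarrow> \<sigma> k \<in> {1..m}"
  using bij by (auto dest: bij_betwE)

lemma pvalue_le_iff:
  assumes "i \<in> {1..m}" "u < 1/2"
  shows "pvalues s i \<le> u \<longleftrightarrow> s i \<and> U i \<le> u"
  using assms U[of i] by (auto simp: signed_pvalues_def signed_pvalue_def)

lemma pvalue_ge_iff:
  assumes "i \<in> {1..m}" "u < 1/2"
  shows "1 - u \<le> pvalues s i \<longleftrightarrow> \<not> s i \<and> U i \<le> u"
  using assms U[of i] by (auto simp: signed_pvalues_def signed_pvalue_def)

lemma card_rank:
  assumes "k \<in> {1..m}"
  shows "card {i\<in>{1..m}. Q i \<and> U i \<le> U (\<sigma> k)} = card {j\<in>{1..k}. Q (\<sigma> j)}"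
proof -
  have "{i\<in>\<sigma> ` {1..m}. Q i \<and> U i \<le> U (\<sigma> k)} =
      \<sigma> ` {j\<in>{1..m}. Q (\<sigma> j) \<and> U (\<sigma> j) \<le> U (\<sigma> k)}"
    by auto
  then have "{i\<in>{1..m}. Q i \<and> U i \<le> U (\<sigma> k)} =
      \<sigma> ` {j\<in>{1..m}. Q (\<sigma> j) \<and> U (\<sigma> j) \<le> U (\<sigma> k)}"
    unfolding bij_betw_imp_surj_on[OF bij] .
  also have "{j\<in>{1..m}. Q (\<sigma> j) \<and> U (\<sigma> j) \<le> U (\<sigma> k)} = {j\<in>{1..k}. Q (\<sigma> j)}"
    using assms sorted by auto
  finally have "{i\<in>{1..m}. Q i \<and> U i \<le> U (\<sigma> k)} = \<sigma> ` {j\<in>{1..k}. Q (\<sigma> j)}" .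
  moreover have "inj_on \<sigma> {j\<in>{1..k}. Q (\<sigma> j)}"
    using assms by (intro inj_on_subset[OF bij_betw_imp_inj_on[OF bij]]) auto
  ultimately show ?thesis
    by (simp only: card_image)
qed

lemma R_count_eq:
  assumes "k \<in> {1..m}"
  shows "R_count m (pvalues s) (U (\<sigma> k)) = card {j\<in>{1..k}. s (\<sigma> j)}"
  using U[OF \<sigma>_in[OF assms]] card_rank[OF assms, of s]
  by (simp add: R_count_def pvalue_le_iff cong: conj_cong)

lemma L_count_eq:
  assumes "k \<in> {1..m}"
  shows "L_count m (pvalues s) (U (\<sigma> k)) = card {j\<in>{1..k}. \<not> s (\<sigma> j)}"
  using U[OF \<sigma>_in[OF assms]] card_rank[OF assms, of "\<lambda>i. \<not> s i"]
  by (simp add: L_count_def pvalue_ge_iff cong: conj_cong)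

lemma walk_eq_counts:
  assumes "k \<in> {1..m}"
  shows "walk s k = int (R_count m (pvalues s) (U (\<sigma> k)))
    - int L * int (L_count m (pvalues s) (U (\<sigma> k)))"
  unfolding R_count_eq[OF assms] L_count_eq[OF assms] walk_def
  by (simp add: sum.If_cases Int_def)

lemma criterion_iff:
  assumes "k \<in> {1..m}"
  shows "(1 + real (L_count m (pvalues s) (U (\<sigma> k))))
      / real (max (R_count m (pvalues s) (U (\<sigma> k))) 1) \<le> 1 / real L \<longleftrightarrow> int L \<le> walk s k"
proof -
  define a b where "a = L_count m (pvalues s) (U (\<sigma> k))" and "b = R_count m (pvalues s) (U (\<sigma> k))"
  have "(1 + real a) / real (max b 1) \<le> 1 / real L \<longleftrightarrow> real ((1 + a) * L) \<le> real (max b 1)"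
    using L by (simp add: divide_le_eq field_simps)
  also have "\<dots> \<longleftrightarrow> (1 + a) * L \<le> max b 1"
    by (rule of_nat_le_iff)
  also have "\<dots> \<longleftrightarrow> (1 + a) * L \<le> b"
    using L mult_le_mono[of 1 "1 + a" 2 L] by (auto simp: max_def)
  also have "\<dots> \<longleftrightarrow> int ((1 + a) * L) \<le> int b"
    by (rule of_nat_le_iff[symmetric])
  finally show ?thesis
    unfolding walk_eq_counts[OF assms] a_def b_def by (simp add: algebra_simps)
qed

lemma mirror_candidates_eq: "mirror_candidates m (pvalues s) = U ` {1..m}"
proof -
  have "min (pvalues s i) (1 - pvalues s i) = U i" if "i \<in> {1..m}" for i
    using U[OF that] that by (auto simp: signed_pvalues_def signed_pvalue_def)
  then have "(\<lambda>i. min (pvalues s i) (1 - pvalues s i)) ` {1..m} = U ` {1..m}"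
    by (intro image_cong) auto
  moreover have "U ` {1..m} \<subseteq> {0<..1/2}"
    using U by (auto simp: less_imp_le)
  ultimately show ?thesis
    by (simp only: mirror_candidates_def) (rule Int_absorb2)
qed

lemma mirror_threshold_cases:
  obtains (empty) "mirror_threshold (1 / real L) m (pvalues s) = 0"
      "\<And>k. k \<in> {1..m} \<Longrightarrow> walk s k < int L"
  | (rank) k where "k \<in> {1..m}" "mirror_threshold (1 / real L) m (pvalues s) = U (\<sigma> k)"
      "int L \<le> walk s k"
proof -
  define S where "S = {u \<in> mirror_candidates m (pvalues s).
    (1 + real (L_count m (pvalues s) u)) / real (max (R_count m (pvalues s) u) 1) \<le> 1 / real L}"
  have "U ` {1..m} = (\<lambda>k. U (\<sigma> k)) ` {1..m}"
    using bij_betw_imp_surj_on[OF bij] by (metis image_image)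
  then have S: "S = (\<lambda>k. U (\<sigma> k)) ` {k\<in>{1..m}. int L \<le> walk s k}"
    unfolding S_def mirror_candidates_eq using criterion_iff by auto
  show ?thesis
  proof (cases "S = {}")
    case True
    moreover from True have "mirror_threshold (1 / real L) m (pvalues s) = 0"
      unfolding mirror_threshold_def S_def[symmetric] by simp
    moreover have "walk s k < int L" if "k \<in> {1..m}" for k
      by (rule ccontr) (use True S that in auto)
    ultimately show ?thesis
      by (intro empty)
  next
    case False
    then have "Max S \<in> S" using S by (intro Max_in) auto
    moreover from False have "mirror_threshold (1 / real L) m (pvalues s) = Max S"
      unfolding mirror_threshold_def S_def[symmetric] by simp
    ultimately show ?thesis
      using S by (auto intro: rank)
  qed
qed

lemma rejection_set_subset: "rejection_set (1 / real L) m (pvalues s) \<subseteq> {i\<in>{1..m}. s i}"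
proof -
  have "mirror_threshold (1 / real L) m (pvalues s) < 1/2"
    using U[OF \<sigma>_in] by (cases rule: mirror_threshold_cases[of s]) auto
  then show ?thesis
    by (auto simp: rejection_set_def pvalue_le_iff)
qed

lemma rejection_set_nonempty_iff:
  "rejection_set (1 / real L) m (pvalues s) \<noteq> {} \<longleftrightarrow> (\<exists>k\<in>{1..m}. int L \<le> walk s k)"
proof (cases rule: mirror_threshold_cases[of s])
  case empty
  have "pvalues s i > 0" if "i \<in> {1..m}" for i
    using U[OF that] that by (auto simp: signed_pvalues_def signed_pvalue_def)
  with empty show ?thesis
    by (force simp: rejection_set_def not_le[symmetric])
next
  case (rank k)
  have "0 \<le> int L * int (L_count m (pvalues s) (U (\<sigma> k)))" by simp
  then have "R_count m (pvalues s) (U (\<sigma> k)) > 0"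
    using rank(3) L unfolding walk_eq_counts[OF rank(1)] by linarith
  with rank show ?thesis
    by (auto simp: rejection_set_def R_count_def card_gt_0_iff)
qed

text \<open>Upward steps have size one, so the walk cannot jump over the level.\<close>

lemma walk_reaches_iff:
  "(\<exists>k\<in>{1..m}. int L \<le> walk s k) \<longleftrightarrow> (\<exists>n\<le>m. walk s n = int L)"
proof
  assume "\<exists>k\<in>{1..m}. int L \<le> walk s k"
  then obtain k where k: "k \<le> m" "int L \<le> walk s k" by auto
  define n where "n = (LEAST k. int L \<le> walk s k)"
  have n: "int L \<le> walk s n" "n \<le> k"
    using k by (auto simp: n_def intro: LeastI Least_le)
  with L obtain n' where n': "n = Suc n'"
    by (cases n) (auto simp: walk_def)
  then have "walk s n' < int L"
    using not_less_Least[of n' "\<lambda>k. int L \<le> walk s k"] by (simp add: n_def[symmetric])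
  moreover have "walk s n \<le> walk s n' + 1"
    by (simp add: walk_def n')
  ultimately show "\<exists>n\<le>m. walk s n = int L"
    using n k by (intro exI[of _ n]) auto
next
  assume "\<exists>n\<le>m. walk s n = int L"
  then obtain n where n: "n \<le> m" "walk s n = int L" by auto
  with L have "n > 0" by (cases n) (auto simp: walk_def)
  with n show "\<exists>k\<in>{1..m}. int L \<le> walk s k" by (intro bexI[of _ n]) auto
qed

end

lemma ex_sorted_magnitudes:
  assumes "L \<ge> 2" "inj_on U {1..m}" "\<And>i. i \<in> {1..m} \<Longrightarrow> U i \<in> {0<..<1/2}"
  obtains \<sigma> where "sorted_magnitudes m L U \<sigma>" "\<And>i. i \<notin> {1..m} \<Longrightarrow> \<sigma> i \<notin> {1..m}"
proof -
  obtain \<sigma> where "bij_betw \<sigma> {1..m} {1..m}" "\<And>i. i \<notin> {1..m} \<Longrightarrow> \<sigma> i \<notin> {1..m}"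
    "\<And>i j. i \<in> {1..m} \<Longrightarrow> j \<in> {1..m} \<Longrightarrow> U (\<sigma> i) \<le> U (\<sigma> j) \<longleftrightarrow> i \<le> j"
    using ex_sorting_permutation[OF assms(2)] by blast
  with assms show ?thesis
    by (intro that[of \<sigma>] sorted_magnitudes.intro) auto
qed

lemma prob_rejection:
  assumes "L \<ge> 2" and U: "inj_on U {1..m}" "\<And>i. i \<in> {1..m} \<Longrightarrow> U i \<in> {0<..<1/2}"
  shows "measure_pmf.prob (Pi_pmf {1..m} False (\<lambda>_. bernoulli_pmf a))
      {s. rejection_set (1 / real L) m (signed_pvalues {1..m} s U) \<noteq> {}} = walk_reach_prob m L a"
proof -
  obtain \<sigma> where sorted: "sorted_magnitudes m L U \<sigma>"
    and \<sigma>: "\<And>i. i \<notin> {1..m} \<Longrightarrow> \<sigma> i \<notin> {1..m}"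
    using ex_sorted_magnitudes assms by blast
  interpret sorted_magnitudes m L U \<sigma> by fact
  let ?g = "\<lambda>b. if b then 1 else - int L"
  let ?S = "Pi_pmf {1..m} False (\<lambda>_. bernoulli_pmf a)"
  have "walk_steps_pmf m L a = map_pmf (\<lambda>s i. if i \<in> {1..m} then ?g (s i) else 0) ?S"
    unfolding walk_steps_pmf_def map_pmf_def
    by (subst Pi_pmf_bind[where d' = False]) simp_all
  also have "?S = map_pmf (\<lambda>s. s \<circ> \<sigma>) ?S"
    using bij \<sigma> by (intro Pi_pmf_bij_betw) auto
  finally have "walk_reach_prob m L a = measure_pmf.prob ?S {s. \<exists>n\<le>m.
      (\<Sum>i=1..n. if i \<in> {1..m} then ?g (s (\<sigma> i)) else 0) = int L}"
    by (simp add: walk_reach_prob_def pmf.map_comp vimage_def comp_def)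
  also have "{s. \<exists>n\<le>m. (\<Sum>i=1..n. if i \<in> {1..m} then ?g (s (\<sigma> i)) else 0) = int L} =
      {s. \<exists>n\<le>m. walk s n = int L}"
  proof -
    have "(\<Sum>i=1..n. if i \<in> {1..m} then ?g (s (\<sigma> i)) else 0) = walk s n" if "n \<le> m" for n s
      unfolding walk_def using that by (intro sum.cong) auto
    then show ?thesis by (simp cong: conj_cong del: atLeastAtMost_iff)
  qed
  finally show ?thesis
    by (simp add: rejection_set_nonempty_iff walk_reaches_iff)
qed

lemma expectation_FDP_labels:
  assumes "finite I" "rejection_set q m P \<subseteq> I"
    and e: "\<And>i. i \<in> rejection_set q m P \<Longrightarrow> e i = d" and d: "d \<in> {0..1}"
  shows "measure_pmf.expectation (Pi_pmf I False (\<lambda>i. bernoulli_pmf (e i))) (\<lambda>J. FDP q m J P) =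
    d * of_bool (rejection_set q m P \<noteq> {})"
proof -
  let ?R = "rejection_set q m P" and ?Q = "Pi_pmf I False (\<lambda>i. bernoulli_pmf (e i))"
  have "?R \<inter> {i\<in>{1..m}. J i} = {i\<in>?R. J i}" for J
    by (auto simp: rejection_set_def)
  then have "FDP q m J P = (\<Sum>i\<in>?R. of_bool (J i)) / real (max (card ?R) 1)" for J
    by (simp only: FDP_def of_nat_card_filter finite_rejection_set of_bool_def)
  then have "measure_pmf.expectation ?Q (\<lambda>J. FDP q m J P) =
      (\<Sum>i\<in>?R. measure_pmf.expectation ?Q (\<lambda>J. of_bool (J i))) / real (max (card ?R) 1)"
    by (simp add: measure_pmf.integrable_const_bound[where B = 1] Bochner_Integration.integral_sum
        del: sum_of_bool_eq)
  also have "(\<Sum>i\<in>?R. measure_pmf.expectation ?Q (\<lambda>J. of_bool (J i))) = (\<Sum>i\<in>?R. d)"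
  proof (intro sum.cong refl)
    fix i assume i: "i \<in> ?R"
    have "measure_pmf.expectation ?Q (\<lambda>J. of_bool (J i) :: real) =
        measure_pmf.expectation (map_pmf (\<lambda>J. J i) ?Q) of_bool"
      by (rule integral_map_pmf[symmetric])
    also have "map_pmf (\<lambda>J. J i) ?Q = bernoulli_pmf d"
      using i assms by (subst Pi_pmf_component) auto
    finally show "measure_pmf.expectation ?Q (\<lambda>J. of_bool (J i)) = d"
      using d by simp
  qed
  also have "(\<Sum>i\<in>?R. d) / real (max (card ?R) 1) = d * of_bool (?R \<noteq> {})"
    using card_gt_0_iff[of ?R] by (auto simp: max_def)
  finally show ?thesis .
qed

section \<open>Averaging over the labels\<close>

lemma Pi_pmf_bind_combine:
  assumes I: "finite I"
  shows "Pi_pmf I (c x0 y0) (\<lambda>_. \<mu> \<bind> (\<lambda>x. map_pmf (c x) (\<kappa> x))) =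
    Pi_pmf I x0 (\<lambda>_. \<mu>) \<bind>
      (\<lambda>f. map_pmf (\<lambda>g i. c (f i) (g i)) (Pi_pmf I y0 (\<lambda>i. \<kappa> (f i))))"
proof -
  have "Pi_pmf I (c x0 y0) (\<lambda>i. map_pmf (c (f i)) (\<kappa> (f i))) =
      map_pmf (\<lambda>g i. c (f i) (g i)) (Pi_pmf I y0 (\<lambda>i. \<kappa> (f i)))"
    if f: "f \<in> set_pmf (Pi_pmf I x0 (\<lambda>_. \<mu>))" for f
  proof -
    have "Pi_pmf I (c x0 y0) (\<lambda>i. map_pmf (c (f i)) (\<kappa> (f i))) =
        map_pmf (\<lambda>g i. if i \<in> I then c (f i) (g i) else c x0 y0) (Pi_pmf I y0 (\<lambda>i. \<kappa> (f i)))"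
      unfolding map_pmf_def by (subst Pi_pmf_bind[OF I, where d' = y0]) (simp add: I)
    also have "\<dots> = map_pmf (\<lambda>g i. c (f i) (g i)) (Pi_pmf I y0 (\<lambda>i. \<kappa> (f i)))"
    proof (intro map_pmf_cong refl ext)
      fix g i assume "g \<in> set_pmf (Pi_pmf I y0 (\<lambda>i. \<kappa> (f i)))"
      then have "i \<notin> I \<Longrightarrow> f i = x0 \<and> g i = y0"
        using f set_Pi_pmf_subset[OF I, of x0 "\<lambda>_. \<mu>"]
          set_Pi_pmf_subset[OF I, of y0 "\<lambda>i. \<kappa> (f i)"] by blast
      then show "(if i \<in> I then c (f i) (g i) else c x0 y0) = c (f i) (g i)"
        by simp
    qed
    finally show ?thesis .
  qed
  then show ?thesis
    by (subst Pi_pmf_bind[OF I, where d' = x0]) (intro bind_pmf_cong refl)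
qed

lemma Pi_pmf_swap_conditioning:
  assumes I: "finite I"
    and joint: "\<mu> \<bind> (\<lambda>x. map_pmf (Pair x) (\<kappa> x)) = \<nu> \<bind> (\<lambda>y. map_pmf (\<lambda>x. (x, y)) (\<kappa>' y))"
  shows "Pi_pmf I x0 (\<lambda>_. \<mu>) \<bind> (\<lambda>f. map_pmf (Pair f) (Pi_pmf I y0 (\<lambda>i. \<kappa> (f i)))) =
    Pi_pmf I y0 (\<lambda>_. \<nu>) \<bind> (\<lambda>g. map_pmf (\<lambda>f. (f, g)) (Pi_pmf I x0 (\<lambda>i. \<kappa>' (g i))))"
proof -
  have "Pi_pmf I x0 (\<lambda>_. \<mu>) \<bind>
          (\<lambda>f. map_pmf (\<lambda>g i. (f i, g i)) (Pi_pmf I y0 (\<lambda>i. \<kappa> (f i)))) =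
        Pi_pmf I y0 (\<lambda>_. \<nu>) \<bind>
          (\<lambda>g. map_pmf (\<lambda>f i. (f i, g i)) (Pi_pmf I x0 (\<lambda>i. \<kappa>' (g i))))"
    using Pi_pmf_bind_combine[OF I, of Pair x0 y0 \<mu> \<kappa>]
      Pi_pmf_bind_combine[OF I, of "\<lambda>y x. (x, y)" y0 x0 \<nu> \<kappa>'] joint
    by simp
  then have "map_pmf (\<lambda>X. (fst \<circ> X, snd \<circ> X)) (Pi_pmf I x0 (\<lambda>_. \<mu>) \<bind>
          (\<lambda>f. map_pmf (\<lambda>g i. (f i, g i)) (Pi_pmf I y0 (\<lambda>i. \<kappa> (f i))))) =
        map_pmf (\<lambda>X. (fst \<circ> X, snd \<circ> X)) (Pi_pmf I y0 (\<lambda>_. \<nu>) \<bind>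
          (\<lambda>g. map_pmf (\<lambda>f i. (f i, g i)) (Pi_pmf I x0 (\<lambda>i. \<kappa>' (g i)))))"
    by simp
  then show ?thesis
    by (simp add: map_bind_pmf pmf.map_comp comp_def)
qed

lemma finite_set_Pi_pmf_bool: "finite I \<Longrightarrow> finite (set_pmf (Pi_pmf I d (p :: _ \<Rightarrow> bool pmf)))"
  by (rule finite_subset[OF set_Pi_pmf_subset']) auto

lemma bernoulli_joint_eq:
  fixes \<pi> p r :: real
  defines "A \<equiv> \<pi> * p + (1 - \<pi>) * r"
  assumes "\<pi> \<in> {0..1}" "p \<in> {0..1}" "r \<in> {0..1}" "A \<in> {0<..<1}"
  shows "bernoulli_pmf \<pi> \<bind> (\<lambda>j. map_pmf (Pair j) (bernoulli_pmf (if j then p else r))) =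
    bernoulli_pmf A \<bind> (\<lambda>s. map_pmf (\<lambda>j. (j, s))
      (bernoulli_pmf (if s then \<pi> * p / A else \<pi> * (1 - p) / (1 - A))))"
proof -
  have 1: "\<pi> * p \<le> A" "\<pi> * (1 - p) \<le> 1 - A"
  proof -
    have "(1 - \<pi>) * r \<ge> 0" "(1 - \<pi>) * (1 - r) \<ge> 0"
      using assms by (auto intro!: mult_nonneg_nonneg)
    then show "\<pi> * p \<le> A" "\<pi> * (1 - p) \<le> 1 - A"
      by (auto simp: A_def algebra_simps)
  qed
  have 2: "\<pi> * p / A \<in> {0..1}" "\<pi> * (1 - p) / (1 - A) \<in> {0..1}"
    using 1 assms by (auto simp: divide_le_eq)
  have 3: "\<pi> * (1 - p) + (1 - \<pi>) * (1 - r) = 1 - A"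
    by (simp add: A_def algebra_simps)
  show ?thesis
  proof (rule pmf_eqI)
    fix x :: "bool \<times> bool"
    obtain a b where x: "x = (a, b)" by fastforce
    show "pmf (bernoulli_pmf \<pi> \<bind> (\<lambda>j. map_pmf (Pair j) (bernoulli_pmf (if j then p else r)))) x =
      pmf (bernoulli_pmf A \<bind> (\<lambda>s. map_pmf (\<lambda>j. (j, s))
        (bernoulli_pmf (if s then \<pi> * p / A else \<pi> * (1 - p) / (1 - A))))) x"
      using assms(2-) 2 3 unfolding x map_pmf_def
      by (cases a; cases b; simp add: pmf_bind indicator_def)
         (simp_all add: field_simps A_def)
  qed
qed

lemma expectation_pmf_integral_swap:
  fixes F :: "'a \<Rightarrow> 'b \<Rightarrow> real"
  assumes "finite (set_pmf p)" "\<And>x. integrable M (F x)"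
  shows "measure_pmf.expectation p (\<lambda>x. \<integral>y. F x y \<partial>M) = (\<integral>y. measure_pmf.expectation p (\<lambda>x. F x y) \<partial>M)"
  using assms by (simp add: integral_measure_pmf[of "set_pmf p"] Bochner_Integration.integral_sum)

lemma expectation_label_FDP:
  fixes \<pi> p r :: real
  defines "A \<equiv> \<pi> * p + (1 - \<pi>) * r"
  assumes "L \<ge> 2" and ranges: "\<pi> \<in> {0..1}" "p \<in> {0..1}" "r \<in> {0..1}" "A \<in> {0<..<1}"
  shows "measure_pmf.expectation (label_pmf m \<pi>)
      (\<lambda>J. \<integral>P. FDP (1 / real L) m J P
        \<partial>PiM {1..m} (\<lambda>i. density lborel (\<lambda>u. ennreal (f0_density (1 - (if J i then p else r)) u)))) =
    \<pi> * p / A * walk_reach_prob m L A"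
proof -
  let ?I = "{1..m}" and ?q = "1 / real L"
  let ?U = "PiM {1..m} (\<lambda>_. half_uniform)"
  define e where "e s = (if s then \<pi> * p / A else \<pi> * (1 - p) / (1 - A))" for s
  define F where "F = (\<lambda>(J, s) U. FDP ?q m J (signed_pvalues ?I s U))"
  define Q where "Q = Pi_pmf ?I False (\<lambda>_. bernoulli_pmf \<pi>) \<bind>
    (\<lambda>J. map_pmf (Pair J) (Pi_pmf ?I False (\<lambda>i. bernoulli_pmf (if J i then p else r))))"
  have Q: "Q = Pi_pmf ?I False (\<lambda>_. bernoulli_pmf A) \<bind>
    (\<lambda>s. map_pmf (\<lambda>J. (J, s)) (Pi_pmf ?I False (\<lambda>i. bernoulli_pmf (e (s i)))))"
    unfolding Q_def e_def
    by (rule Pi_pmf_swap_conditioning)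
       (use bernoulli_joint_eq[OF ranges[unfolded A_def], folded A_def] in auto)
  have d: "\<pi> * p / A \<in> {0..1}"
    using ranges by (auto simp: A_def divide_le_eq)
  have "finite (set_pmf Q)"
    by (auto simp: Q_def set_bind_pmf finite_set_Pi_pmf_bool)
  interpret U: product_prob_space "\<lambda>_. half_uniform" ?I
    by (intro product_prob_spaceI prob_space_half_uniform)
  have F_le: "\<bar>F x U\<bar> \<le> 1" for x U
    by (simp add: F_def abs_FDP_le_1 split: prod.split)
  have F_measurable: "F x \<in> borel_measurable ?U" for x
    unfolding F_def by (cases x) simp
  have F_int: "integrable ?U (F x)" for x
    using F_le F_measurable by (intro U.integrable_const_bound[where B = 1]) auto
  have "\<bar>\<integral>U. F x U \<partial>?U\<bar> \<le> 1" for x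
  proof -
    have "\<bar>\<integral>U. F x U \<partial>?U\<bar> \<le> (\<integral>U. \<bar>F x U\<bar> \<partial>?U)"
      by (rule integral_abs_bound)
    also have "\<dots> \<le> 1"
      using F_int F_le by (intro U.integral_le_const) auto
    finally show ?thesis .
  qed
  then have "measure_pmf.expectation Q (\<lambda>x. \<integral>U. F x U \<partial>?U) =
      measure_pmf.expectation (label_pmf m \<pi>) (\<lambda>J.
        measure_pmf.expectation (Pi_pmf ?I False (\<lambda>i. bernoulli_pmf (if J i then p else r)))
          (\<lambda>s. \<integral>U. F (J, s) U \<partial>?U))"
    unfolding Q_def label_pmf_def by (subst expectation_bind_pmf[where B = 1]) simp_all
  also have "\<dots> = measure_pmf.expectation (label_pmf m \<pi>) (\<lambda>J. \<integral>P. FDP ?q m J P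
      \<partial>PiM {1..m} (\<lambda>i. density lborel (\<lambda>u. ennreal (f0_density (1 - (if J i then p else r)) u))))"
    using ranges by (subst integral_PiM_f0_density[where B = 1]) (auto simp: F_def abs_FDP_le_1)
  finally have "measure_pmf.expectation (label_pmf m \<pi>) (\<lambda>J. \<integral>P. FDP ?q m J P
      \<partial>PiM {1..m} (\<lambda>i. density lborel (\<lambda>u. ennreal (f0_density (1 - (if J i then p else r)) u)))) =
      (\<integral>U. measure_pmf.expectation Q (\<lambda>x. F x U) \<partial>?U)"
    using expectation_pmf_integral_swap[OF \<open>finite (set_pmf Q)\<close> F_int] by simp
  also have "\<dots> = (\<integral>U. \<pi> * p / A * walk_reach_prob m L A \<partial>?U)"
  proof (rule integral_cong_AE)
    show "AE U in ?U. measure_pmf.expectation Q (\<lambda>x. F x U) = \<pi> * p / A * walk_reach_prob m L A"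
      using AE_half_uniform_inj[OF finite_atLeastAtMost]
    proof eventually_elim
      case (elim U)
      then have U: "inj_on U ?I" "\<And>i. i \<in> ?I \<Longrightarrow> U i \<in> {0<..<1/2}" by auto
      obtain \<sigma> where "sorted_magnitudes m L U \<sigma>"
        using ex_sorted_magnitudes[OF \<open>L \<ge> 2\<close> U] by blast
      then have rej: "rejection_set ?q m (signed_pvalues ?I s U) \<subseteq> {i\<in>?I. s i}" for s
        by (rule sorted_magnitudes.rejection_set_subset)
      have "measure_pmf.expectation Q (\<lambda>x. F x U) =
          measure_pmf.expectation (Pi_pmf ?I False (\<lambda>_. bernoulli_pmf A)) (\<lambda>s.
            measure_pmf.expectation (Pi_pmf ?I False (\<lambda>i. bernoulli_pmf (e (s i))))
              (\<lambda>J. FDP ?q m J (signed_pvalues ?I s U)))"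
        unfolding Q by (subst expectation_bind_pmf[OF F_le]) (simp add: F_def)
      also have "\<dots> = measure_pmf.expectation (Pi_pmf ?I False (\<lambda>_. bernoulli_pmf A))
          (\<lambda>s. \<pi> * p / A * indicator {s. rejection_set ?q m (signed_pvalues ?I s U) \<noteq> {}} s)"
      proof (intro arg_cong[where f = "measure_pmf.expectation _"] ext)
        fix s
        have "measure_pmf.expectation (Pi_pmf ?I False (\<lambda>i. bernoulli_pmf (e (s i))))
              (\<lambda>J. FDP ?q m J (signed_pvalues ?I s U)) =
            \<pi> * p / A * of_bool (rejection_set ?q m (signed_pvalues ?I s U) \<noteq> {})"
          using rej[of s] d by (intro expectation_FDP_labels) (auto simp: e_def)
        then show "measure_pmf.expectation (Pi_pmf ?I False (\<lambda>i. bernoulli_pmf (e (s i))))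
              (\<lambda>J. FDP ?q m J (signed_pvalues ?I s U)) =
            \<pi> * p / A * indicator {s. rejection_set ?q m (signed_pvalues ?I s U) \<noteq> {}} s"
          by (simp add: indicator_def)
      qed
      also have "\<dots> = \<pi> * p / A * measure_pmf.prob (Pi_pmf ?I False (\<lambda>_. bernoulli_pmf A))
          {s. rejection_set ?q m (signed_pvalues ?I s U) \<noteq> {}}"
        by (subst integral_mult_right_zero) simp
      also have "\<dots> = \<pi> * p / A * walk_reach_prob m L A"
        by (simp only: prob_rejection[OF \<open>L \<ge> 2\<close> U])
      finally show ?case .
    qed
  next
    show "(\<lambda>U. measure_pmf.expectation Q (\<lambda>x. F x U)) \<in> borel_measurable ?U"
    proof -
      have "measure_pmf.expectation Q (\<lambda>x. F x U) = (\<Sum>x\<in>set_pmf Q. pmf Q x * F x U)" for U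
        by (subst integral_measure_pmf[OF \<open>finite (set_pmf Q)\<close>]) simp_all
      then show ?thesis
        by (simp only:) (intro borel_measurable_sum borel_measurable_times
            borel_measurable_const F_measurable)
    qed
  qed simp
  finally show ?thesis
    by (simp add: prob_space.prob_space[OF prob_space_PiM[OF prob_space_half_uniform]])
qed

text \<open>Reflecting \<open>f\<^sub>0\<close> exchanges \<open>\<epsilon>\<close> and \<open>1 - \<epsilon>\<close>, so every density of the model is an
  \<open>f0_density\<close> with its own parameter.\<close>

lemma null_density_eq: "null_density \<epsilon> h = f0_density (if h = 0 then \<epsilon> else 1 - \<epsilon>)"
  by (auto simp: null_density_def f0_density_def fun_eq_iff)

lemma alt_density_eq: "alt_density r = f0_density (1 - r)"
  by (auto simp: alt_density_def f0_density_def fun_eq_iff)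

lemma pvalue_law_given_eq:
  "pvalue_law_given \<epsilon> r m J h = PiM {1..m} (\<lambda>i. density lborel
     (\<lambda>u. ennreal (f0_density (1 - (if J i then if h = 0 then 1 - \<epsilon> else \<epsilon> else r)) u)))"
  unfolding pvalue_law_given_def
  by (intro PiM_cong refl) (auto simp: null_density_eq alt_density_eq)

lemma FDR_eq_mixture:
  assumes "\<epsilon> \<in> {0..1}" "r \<in> {0..1}"
  shows "FDR q \<epsilon> r m J = 1/2 * (\<Sum>h=0..1. \<integral>P. FDP q m J P \<partial>pvalue_law_given \<epsilon> r m J h)"
proof -
  have prob: "prob_space (pvalue_law_given \<epsilon> r m J h)" for h
    unfolding pvalue_law_given_eq using assms
    by (intro prob_space_PiM prob_space_f0_density) auto
  have "sets (pvalue_law_given \<epsilon> r m J h) = sets (PiM {1..m} (\<lambda>_. borel))" for h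
    unfolding pvalue_law_given_def by (intro sets_PiM_cong) auto
  then have "FDR q \<epsilon> r m J =
      measure_pmf.expectation latent_state_pmf (\<lambda>h. \<integral>P. FDP q m J P \<partial>pvalue_law_given \<epsilon> r m J h)"
    unfolding FDR_def pvalue_law_def using prob
    by (intro integral_bind[where K = "PiM {1..m} (\<lambda>_. borel)" and B = 1 and B' = 1])
       (auto simp: space_subprob_algebra abs_FDP_le_1 measure_pmf.finite_measure
         prob_space.emeasure_space_1 intro: prob_space_imp_subprob_space)
  moreover have "{0..1::nat} = {0, 1}" by auto
  ultimately show ?thesis
    by (simp add: latent_state_pmf_def)
qed

lemma (in prob_space) ex_expectation_le:
  fixes X :: "'a \<Rightarrow> real"
  assumes "integrable M X"
  shows "\<exists>x\<in>space M. expectation X \<le> X x"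
proof (rule ccontr)
  assume "\<not> ?thesis"
  then have "expectation X < expectation X"
    using assms by (intro expectation_less) (auto simp: not_le)
  then show False by simp
qed

theorem proposition6:
  fixes L m :: nat and q \<epsilon> r \<pi>0 \<pi>1 :: real and p A d :: "nat \<Rightarrow> real"
  assumes "L \<ge> 2" and "q = 1 / real L"
    and "0 < \<epsilon>" and "\<epsilon> < 1/2"
    and "1/2 < r" and "r < 1"
    and "m \<ge> 1"
    and "0 < \<pi>0" and "\<pi>0 < 1" and "\<pi>1 = 1 - \<pi>0"
    and "p 0 = 1 - \<epsilon>" and "p 1 = \<epsilon>"
    and "\<And>h. h \<in> {0, 1} \<Longrightarrow> A h = \<pi>0 * p h + \<pi>1 * r"
    and "\<And>h. h \<in> {0, 1} \<Longrightarrow> d h = \<pi>0 * p h / A h"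
  shows "(\<forall>a\<in>{0..1}. G m L a = walk_reach_prob m L a)
    \<and> measure_pmf.expectation (label_pmf m \<pi>0) (\<lambda>J. FDR q \<epsilon> r m J)
        = 1/2 * (\<Sum>h=0..1. d h * G m L (A h))
    \<and> (\<exists>J. FDR q \<epsilon> r m J \<ge> 1/2 * (\<Sum>h=0..1. d h * G m L (A h)))"
proof -
  let ?FDR_given = "\<lambda>h J. \<integral>P. FDP q m J P \<partial>pvalue_law_given \<epsilon> r m J h"
  have integrable: "integrable (label_pmf m \<pi>0) X" for X :: "(nat \<Rightarrow> bool) \<Rightarrow> real"
    unfolding label_pmf_def by (intro integrable_measure_pmf_finite finite_set_Pi_pmf_bool) simp
  have given: "measure_pmf.expectation (label_pmf m \<pi>0) (?FDR_given h) = d h * G m L (A h)"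
    if h: "h \<in> {0, 1}" for h
  proof -
    have p: "p h = (if h = 0 then 1 - \<epsilon> else \<epsilon>)"
      using h assms by auto
    then have p_range: "p h \<in> {0<..<1}"
      using assms by auto
    have A: "A h = \<pi>0 * p h + (1 - \<pi>0) * r"
      using assms h by simp
    have "A h > 0"
      unfolding A using assms p_range by (intro add_pos_pos mult_pos_pos) auto
    moreover have "\<pi>0 * (1 - p h) + (1 - \<pi>0) * (1 - r) > 0"
      using assms p_range by (intro add_pos_pos mult_pos_pos) auto
    then have "A h < 1"
      unfolding A by (simp add: algebra_simps)
    ultimately have "measure_pmf.expectation (label_pmf m \<pi>0) (?FDR_given h) =
        \<pi>0 * p h / A h * walk_reach_prob m L (A h)"
      using assms(1,3-9) p_range unfolding pvalue_law_given_eq p[symmetric] assms(2) A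
      by (intro expectation_label_FDP) auto
    then show ?thesis
      using assms h \<open>A h > 0\<close> \<open>A h < 1\<close> by (simp add: G_eq_walk_reach_prob)
  qed
  have "measure_pmf.expectation (label_pmf m \<pi>0) (FDR q \<epsilon> r m) =
      measure_pmf.expectation (label_pmf m \<pi>0) (\<lambda>J. 1/2 * (\<Sum>h=0..1. ?FDR_given h J))"
    using assms by (intro Bochner_Integration.integral_cong refl FDR_eq_mixture) auto
  also have "\<dots> = 1/2 * (\<Sum>h=0..1. measure_pmf.expectation (label_pmf m \<pi>0) (?FDR_given h))"
    by (simp only: integral_mult_right_zero Bochner_Integration.integral_sum integrable)
  also have "\<dots> = 1/2 * (\<Sum>h=0..1. d h * G m L (A h))"
    by (intro arg_cong[where f = "(*) (1/2)"] sum.cong refl given) auto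
  finally have eq: "measure_pmf.expectation (label_pmf m \<pi>0) (\<lambda>J. FDR q \<epsilon> r m J) =
      1/2 * (\<Sum>h=0..1. d h * G m L (A h))" .
  then have "\<exists>J. FDR q \<epsilon> r m J \<ge> 1/2 * (\<Sum>h=0..1. d h * G m L (A h))"
    using measure_pmf.ex_expectation_le[OF integrable, of "FDR q \<epsilon> r m"] by metis
  with eq show ?thesis
    using G_eq_walk_reach_prob[OF assms(1)] by blast
qed

end
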